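(* Consider the branching coalescing random walk on $\{0,1\}^{\mathbb Z}$ with positive rates $p,q,c_r,c_l,b_l,b_r$, and put $B=b_l+b_r$, $C=c_l+c_r$, $\varrho^*=\frac{B}{B+C}$. For $j\in\mathbb Z$ let $\underline\mu_j$ be the product measure on $\{0,1\}^{\mathbb Z}$ which has density $\varrho^*$ at sites $i<j$, a particle with probability one at site $j$, and no particles at sites $i>j$. If $$p=b_r\cdot\frac CB,$$ then, for every $j\in\mathbb Z$, the identity $$\frac{\mathrm d}{\mathrm dt}\,\underline\mu_jS(t)\Bigr|_{t=0}=P\cdot[\underline\mu_{j+1}-\underline\mu_j]+Q\cdot[\underline\mu_{j-1}-\underline\mu_j]$$ holds (in the sense of test functions), with $$P=p\cdot\frac{C+B}{C}\qquad\text{and}\qquad Q=q\cdot\frac{C}{C+B}+c_l\cdot\frac{B}{C+B}.$$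
   Context: For $\underline\omega\in\{0,1\}^{\mathbb Z}$: $\underline\omega^{i,j}$ is obtained from $\underline\omega$ by replacing $\omega_i$ by $\omega_i-1$ and $\omega_j$ by $\omega_j+1$; $\underline\omega^{i\uparrow}$ by replacing $\omega_i$ by $\omega_i+1$; $\underline\omega^{i\downarrow}$ by replacing $\omega_i$ by $\omega_i-1$. The branching coalescing random walk is the Markov process on $\{0,1\}^{\mathbb Z}$ whose generator acts on functions $\varphi$ depending on finitely many coordinates (finite cylinder functions) by $$\begin{aligned}(L\varphi)(\underline\omega)=\sum_{i\in\mathbb Z}\bigl\{&p\,\omega_i(1-\omega_{i+1})[\varphi(\underline\omega^{i,i+1})-\varphi(\underline\omega)]+q\,(1-\omega_i)\omega_{i+1}[\varphi(\underline\omega^{i+1,i})-\varphi(\underline\omega)]\\&+c_r\,\omega_i\omega_{i+1}[\varphi(\underline\omega^{i\downarrow})-\varphi(\underline\omega)]+c_l\,\omega_i\omega_{i+1}[\varphi(\underline\omega^{(i+1)\downarrow})-\varphi(\underline\omega)]\\&+b_l\,(1-\omega_i)\omega_{i+1}[\varphi(\underline\omega^{i\uparrow})-\varphi(\underline\omega)]+b_r\,\omega_i(1-\omega_{i+1})[\varphi(\underline\omega^{(i+1)\uparrow})-\varphi(\underline\omega)]\bigr\}\end{aligned}$$ (only finitely many terms are nonzero; terms with zero rate are taken to be zero). $\underline\mu S(t)$ denotes the law of the process at time $t$ when started from the law $\underline\mu$. The identity is understood in the sense of test functions: for every finite cylinder function $\varphi$, $\frac{\mathrm d}{\mathrm dt}\int\varphi\,\mathrm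 d(\underline\mu_jS(t))\big|_{t=0}=\int L\varphi\,\mathrm d\underline\mu_j$ equals $P\bigl[\int\varphi\,\mathrm d\underline\mu_{j+1}-\int\varphi\,\mathrm d\underline\mu_j\bigr]+Q\bigl[\int\varphi\,\mathrm d\underline\mu_{j-1}-\int\varphi\,\mathrm d\underline\mu_j\bigr]$. (The identity is what the paper means by saying that the rightmost particle performs a simple random walk with right jump rate $P$ and left jump rate $Q$.) *)

theory Defs
  imports "HOL-Probability.Probability"
begin

text \<open>
  A configuration in \<open>{0,1}\<^sup>\<int>\<close> is a function \<open>int \<Rightarrow> bool\<close>, where \<open>True\<close> means that the site is
  occupied; \<open>int \<Rightarrow> bool\<close> carries the product topology of the discrete topology on \<open>bool\<close>.
\<close>

type_synonym config = "int \<Rightarrow> bool"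

definition config_space :: "config measure" where
  "config_space = (\<Pi>\<^sub>M i\<in>UNIV. count_space UNIV)"

definition finite_cylinder :: "(config \<Rightarrow> real) \<Rightarrow> bool" where
  "finite_cylinder \<phi> \<longleftrightarrow>
     (\<exists>A. finite A \<and> (\<forall>\<omega> \<eta>. (\<forall>i\<in>A. \<omega> i = \<eta> i) \<longrightarrow> \<phi> \<omega> = \<phi> \<eta>))"

abbreviation occ :: "config \<Rightarrow> int \<Rightarrow> real" where
  "occ \<omega> i \<equiv> of_bool (\<omega> i)"

text \<open>
  In the generator each of the following modifications is multiplied by a factor that vanishes
  unless a site to be decreased is occupied and a site to be increased is empty. Hence decreasing
  means setting to \<open>False\<close> and increasing means setting to \<open>True\<close>.
\<close>

definition jump :: "config \<Rightarrow> int \<Rightarrow> int \<Rightarrow> config" where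
  "jump \<omega> i j = (\<omega>)(i := False, j := True)"

definition up :: "config \<Rightarrow> int \<Rightarrow> config" where
  "up \<omega> i = (\<omega>)(i := True)"

definition down :: "config \<Rightarrow> int \<Rightarrow> config" where
  "down \<omega> i = (\<omega>)(i := False)"

text \<open>
  For a finite cylinder function only finitely many terms are nonzero, so \<open>\<Sum>\<^sub>\<infinity>\<close> is a finite sum.
\<close>

definition bcrw_gen ::
    "real \<Rightarrow> real \<Rightarrow> real \<Rightarrow> real \<Rightarrow> real \<Rightarrow> real \<Rightarrow> (config \<Rightarrow> real) \<Rightarrow> config \<Rightarrow> real" where
  "bcrw_gen p q c\<^sub>r c\<^sub>l b\<^sub>l b\<^sub>r \<phi> \<omega> = (\<Sum>\<^sub>\<infinity>i\<in>UNIV.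
       p * occ \<omega> i * (1 - occ \<omega> (i + 1)) * (\<phi> (jump \<omega> i (i + 1)) - \<phi> \<omega>)
     + q * (1 - occ \<omega> i) * occ \<omega> (i + 1) * (\<phi> (jump \<omega> (i + 1) i) - \<phi> \<omega>)
     + c\<^sub>r * occ \<omega> i * occ \<omega> (i + 1) * (\<phi> (down \<omega> i) - \<phi> \<omega>)
     + c\<^sub>l * occ \<omega> i * occ \<omega> (i + 1) * (\<phi> (down \<omega> (i + 1)) - \<phi> \<omega>)
     + b\<^sub>l * (1 - occ \<omega> i) * occ \<omega> (i + 1) * (\<phi> (up \<omega> i) - \<phi> \<omega>)
     + b\<^sub>r * occ \<omega> i * (1 - occ \<omega> (i + 1)) * (\<phi> (up \<omega> (i + 1)) - \<phi> \<omega>))"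

text \<open>
  A Markov process is given by its transition kernels: \<open>K t \<omega>\<close> is the law at time \<open>t\<close> of the
  process started from \<open>\<omega>\<close>. Only the kernels with \<open>t \<ge> 0\<close> matter.
\<close>

definition semigroup_op :: "(real \<Rightarrow> config \<Rightarrow> config measure) \<Rightarrow> real \<Rightarrow> (config \<Rightarrow> real) \<Rightarrow> config \<Rightarrow> real"
  where "semigroup_op K t f \<omega> = (\<integral>\<eta>. f \<eta> \<partial>K t \<omega>)"

definition feller_process :: "(real \<Rightarrow> config \<Rightarrow> config measure) \<Rightarrow> bool" where
  "feller_process K \<longleftrightarrow>
     (\<forall>t\<ge>0. K t \<in> config_space \<rightarrow>\<^sub>M prob_algebra config_space) \<and>
     (\<forall>\<omega>. K 0 \<omega> = return config_space \<omega>) \<and>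
     (\<forall>s\<ge>0. \<forall>t\<ge>0. \<forall>\<omega>. K (s + t) \<omega> = K s \<omega> \<bind> K t) \<and>
     (\<forall>f. continuous_on UNIV f \<longrightarrow>
        (\<forall>t\<ge>0. continuous_on UNIV (semigroup_op K t f)) \<and>
        uniform_limit UNIV (\<lambda>t. semigroup_op K t f) f (at_right 0))"

text \<open>
  \<open>has_generator_value K f g\<close>: the function \<open>f\<close> lies in the domain of the infinitesimal generator
  of \<open>K\<close>, and the generator maps it to \<open>g\<close>.
\<close>

definition has_generator_value ::
    "(real \<Rightarrow> config \<Rightarrow> config measure) \<Rightarrow> (config \<Rightarrow> real) \<Rightarrow> (config \<Rightarrow> real) \<Rightarrow> bool" where
  "has_generator_value K f g \<longleftrightarrow> continuous_on UNIV f \<and> continuous_on UNIV g \<and>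
     uniform_limit UNIV (\<lambda>t \<omega>. (semigroup_op K t f \<omega> - f \<omega>) / t) g (at_right 0)"

definition bcrw_process ::
    "real \<Rightarrow> real \<Rightarrow> real \<Rightarrow> real \<Rightarrow> real \<Rightarrow> real \<Rightarrow> (real \<Rightarrow> config \<Rightarrow> config measure) \<Rightarrow> bool" where
  "bcrw_process p q c\<^sub>r c\<^sub>l b\<^sub>l b\<^sub>r K \<longleftrightarrow> feller_process K \<and>
     (\<forall>\<phi>. finite_cylinder \<phi> \<longrightarrow>
        has_generator_value K \<phi> (bcrw_gen p q c\<^sub>r c\<^sub>l b\<^sub>l b\<^sub>r \<phi>))"

definition evolved_law ::
    "config measure \<Rightarrow> (real \<Rightarrow> config \<Rightarrow> config measure) \<Rightarrow> real \<Rightarrow> config measure" where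
  "evolved_law \<mu> K t = \<mu> \<bind> K t"

definition shock_measure :: "real \<Rightarrow> int \<Rightarrow> config measure" where
  "shock_measure \<rho> j =
     (\<Pi>\<^sub>M i\<in>UNIV. measure_pmf (bernoulli_pmf (if i < j then \<rho> else if i = j then 1 else 0)))"

end

theory Submission
  imports Defs
begin

text \<open>
  The derivative of \<open>\<integral>\<phi> d(\<mu>\<^sub>j S(t))\<close> at \<open>0\<close> is \<open>\<integral>L\<phi> d\<mu>\<^sub>j\<close> because \<open>\<phi>\<close> lies in the domain of the
  generator and the difference quotients converge uniformly in the starting configuration, so that
  the limit may be taken under the integral (\<open>has_real_derivative_evolved_law\<close>).

  The rest is a computation of \<open>\<integral>L\<phi> d\<mu>\<^sub>j\<close> (\<open>integral_bcrw_gen_shock_measure\<close>). The generator is a sum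
  over bonds \<open>(i, i + 1)\<close>, and since the measure is a product, conditioning on the two sites of a bond
  expresses the expectation of the bond term by the four numbers
  \<open>e b c = \<integral>\<phi>(\<omega> with \<omega>\<^sub>i = b, \<omega>\<^sub>i\<^sub>+\<^sub>1 = c) d\<mu>\<^sub>j\<close>. There are four kinds of bonds.

  \<^item> To the right of the shock every rate vanishes.

  \<^item> To the left of the shock, \<open>B (1 - \<rho>) = C \<rho>\<close> says that branching and coalescence across a bond are
    balanced. What remains is a multiple \<open>\<kappa>\<close> of \<open>\<integral>(\<omega>\<^sub>i - \<omega>\<^sub>i\<^sub>+\<^sub>1) \<phi> d\<mu>\<^sub>j\<close>, which telescopes. Far to the left
    \<open>\<omega>\<^sub>i\<close> is independent of \<open>\<phi>\<close>, so that these bonds contribute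
    \<open>\<kappa> (\<rho> \<integral>\<phi> d\<mu>\<^sub>j - \<integral>\<omega>\<^sub>j\<^sub>-\<^sub>1 \<phi> d\<mu>\<^sub>j)\<close> in total.

  \<^item> On the bond \<open>(j, j + 1)\<close> the rightmost particle jumps with rate \<open>p\<close>, leaving \<open>j\<close> empty, and branches
    with rate \<open>b\<^sub>r\<close>, leaving \<open>j\<close> occupied. The condition \<open>p = b\<^sub>r C / B\<close> says that
    \<open>p : b\<^sub>r = (1 - \<rho>) : \<rho>\<close>. So site \<open>j\<close> is left behind with density \<open>\<rho>\<close>, which is the law \<open>\<mu>\<^sub>j\<^sub>+\<^sub>1\<close>, at
    total rate \<open>P = p + b\<^sub>r\<close>.

  \<^item> On the bond \<open>(j - 1, j)\<close> the rightmost particle retreats to \<open>j - 1\<close> by a jump (rate \<open>q\<close>, if \<open>j - 1\<close> is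
    empty) or by coalescence (rate \<open>c\<^sub>l\<close>, if it is occupied), at total rate \<open>Q = q (1 - \<rho>) + c\<^sub>l \<rho>\<close>.
    This rate depends on the state of \<open>j - 1\<close>, which moreover changes by the rates \<open>c\<^sub>r\<close> and \<open>b\<^sub>l\<close>; the
    resulting deviations from the density \<open>\<rho>\<close> at \<open>j - 1\<close> cancel against the boundary term of the
    telescoping sum.
\<close>

section \<open>Finite cylinder functions\<close>

lemma finite_cylinder_const: "finite_cylinder (\<lambda>\<omega>. c)"
  unfolding finite_cylinder_def by (intro exI[of _ "{}"]) simp

lemma finite_cylinder_occ: "finite_cylinder (\<lambda>\<omega>. occ \<omega> i)"
  unfolding finite_cylinder_def by (intro exI[of _ "{i}"]) simp

lemma finite_cylinder_combine:
  assumes "finite_cylinder f" "finite_cylinder g"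
  shows "finite_cylinder (\<lambda>\<omega>. h (f \<omega>) (g \<omega>))"
proof -
  obtain A B where "finite A" "\<And>\<omega> \<eta>. (\<forall>i\<in>A. \<omega> i = \<eta> i) \<Longrightarrow> f \<omega> = f \<eta>"
    and "finite B" "\<And>\<omega> \<eta>. (\<forall>i\<in>B. \<omega> i = \<eta> i) \<Longrightarrow> g \<omega> = g \<eta>"
    using assms unfolding finite_cylinder_def by metis
  then show ?thesis
    unfolding finite_cylinder_def by (intro exI[of _ "A \<union> B"]) (metis UnCI finite_UnI)
qed

lemma finite_cylinder_update:
  assumes "finite_cylinder f"
  shows "finite_cylinder (\<lambda>\<omega>. f ((\<omega>)(i := b)))"
proof -
  obtain A where "finite A" and A: "\<And>\<omega> \<eta>. (\<forall>i\<in>A. \<omega> i = \<eta> i) \<Longrightarrow> f \<omega> = f \<eta>"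
    using assms unfolding finite_cylinder_def by metis
  then show ?thesis
    unfolding finite_cylinder_def by (intro exI[of _ A]) (auto intro!: A)
qed

lemma finite_cylinder_sum:
  assumes "\<And>i. i \<in> I \<Longrightarrow> finite_cylinder (f i)"
  shows "finite_cylinder (\<lambda>\<omega>. \<Sum>i\<in>I. f i \<omega>)"
  using assms
proof (induction I rule: infinite_finite_induct)
  case (insert i I)
  then show ?case
    using finite_cylinder_combine[of "f i" "\<lambda>\<omega>. \<Sum>i\<in>I. f i \<omega>" "(+)"] by simp
qed (simp_all add: finite_cylinder_const)

text \<open>
  A cylinder function is a finite decision tree that reads one site at each node. Measurability and
  boundedness follow by induction on such trees.
\<close>

lemma finite_cylinder_induct [consumes 1, case_names const split]:
  assumes "finite_cylinder f"
    and const: "\<And>c. P (\<lambda>\<omega>. c)"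
    and split: "\<And>i g h. P g \<Longrightarrow> P h \<Longrightarrow> P (\<lambda>\<omega>. if \<omega> i then g \<omega> else h \<omega>)"
  shows "P f"
proof -
  obtain A where "finite A" "\<And>\<omega> \<eta>. (\<forall>i\<in>A. \<omega> i = \<eta> i) \<Longrightarrow> f \<omega> = f \<eta>"
    using assms unfolding finite_cylinder_def by metis
  then show ?thesis
  proof (induction A arbitrary: f)
    case empty
    have "f \<omega> = f undefined" for \<omega>
      by (rule empty.prems) simp
    then have "f = (\<lambda>\<omega>. f undefined)" by (rule ext)
    then show ?case using const by metis
  next
    case (insert i A)
    have "P (\<lambda>\<omega>. f ((\<omega>)(i := b)))" for b
      by (rule insert.IH) (rule insert.prems, simp)
    then have "P (\<lambda>\<omega>. if \<omega> i then f ((\<omega>)(i := True)) else f ((\<omega>)(i := False)))"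
      by (intro split)
    moreover have "(if \<omega> i then f ((\<omega>)(i := True)) else f ((\<omega>)(i := False))) = f \<omega>" for \<omega>
      using fun_upd_triv[of \<omega> i] by (cases "\<omega> i") simp_all
    ultimately show ?case by simp
  qed
qed

lemma space_config_space [simp]: "space config_space = UNIV"
  by (simp add: config_space_def space_PiM)

lemma finite_cylinder_measurable:
  assumes "finite_cylinder f"
  shows "f \<in> borel_measurable config_space"
  using assms
proof (induction rule: finite_cylinder_induct)
  case (split i g h)
  have "(\<lambda>\<omega>. \<omega> i) \<in> config_space \<rightarrow>\<^sub>M count_space UNIV"
    unfolding config_space_def by (rule measurable_component_singleton) simp
  then show ?case
    using split.IH by (intro measurable_If) (simp_all add: pred_def)
qed simp

lemma finite_cylinder_bounded:
  assumes "finite_cylinder f"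
  obtains M where "\<And>\<omega>. \<bar>f \<omega>\<bar> \<le> M"
proof -
  have "\<exists>M. \<forall>\<omega>. \<bar>f \<omega>\<bar> \<le> M"
    using assms
  proof (induction rule: finite_cylinder_induct)
    case (split i g h)
    then obtain M N where "\<And>\<omega>. \<bar>g \<omega>\<bar> \<le> M" "\<And>\<omega>. \<bar>h \<omega>\<bar> \<le> N" by metis
    then have "\<forall>\<omega>. \<bar>if \<omega> i then g \<omega> else h \<omega>\<bar> \<le> max M N"
      by (simp add: le_max_iff_disj)
    then show ?case by blast
  qed auto
  then show ?thesis using that by auto
qed

section \<open>Bernoulli product measures\<close>

definition bernoulli_field :: "(int \<Rightarrow> real) \<Rightarrow> config measure" where
  "bernoulli_field r = (\<Pi>\<^sub>M i\<in>UNIV. measure_pmf (bernoulli_pmf (r i)))"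

lemma sets_bernoulli_field [measurable_cong, simp]:
  "sets (bernoulli_field r) = sets config_space"
  unfolding bernoulli_field_def config_space_def by (intro sets_PiM_cong) auto

lemma space_bernoulli_field [simp]: "space (bernoulli_field r) = UNIV"
  by (simp add: bernoulli_field_def space_PiM)

lemma prob_space_bernoulli_field: "prob_space (bernoulli_field r)"
  unfolding bernoulli_field_def by (intro prob_space_PiM) (rule prob_space_measure_pmf)

lemma measurable_bernoulli_field [simp]:
  "bernoulli_field r \<rightarrow>\<^sub>M N = config_space \<rightarrow>\<^sub>M N"
  by (rule measurable_cong_sets) simp_all

lemma finite_cylinder_integrable:
  assumes "finite_cylinder f"
  shows "integrable (bernoulli_field r) f"
proof -
  interpret prob_space "bernoulli_field r" by (rule prob_space_bernoulli_field)
  obtain M where "\<And>\<omega>. \<bar>f \<omega>\<bar> \<le> M" by (rule finite_cylinder_bounded[OF assms]) blast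
  then show ?thesis
    using finite_cylinder_measurable[OF assms]
    by (intro integrable_const_bound[of _ M]) auto
qed

text \<open>
  Independence of site \<open>i\<close> from all the others: the field is the image of the product of the two laws
  under the map that inserts the value at \<open>i\<close>, and Fubini's theorem applies.
\<close>

lemma integral_bernoulli_field_site:
  assumes f: "finite_cylinder f"
  shows "(\<integral>\<omega>. f \<omega> \<partial>bernoulli_field r) =
    (\<integral>x. (\<integral>\<eta>. f (\<eta>(i := x)) \<partial>(\<Pi>\<^sub>M k\<in>UNIV - {i}. measure_pmf (bernoulli_pmf (r k))))
       \<partial>bernoulli_pmf (r i))"
proof -
  let ?M = "\<lambda>k. measure_pmf (bernoulli_pmf (r k))"
  let ?R = "\<Pi>\<^sub>M k\<in>UNIV - {i}. ?M k"
  interpret R: prob_space ?R by (intro prob_space_PiM) (rule prob_space_measure_pmf)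
  interpret P: pair_prob_space "?M i" ?R
    by (simp add: pair_prob_space_def pair_sigma_finite_def prob_space_measure_pmf
        prob_space_imp_sigma_finite R.prob_space_axioms)
  have fm: "f \<in> borel_measurable (Pi\<^sub>M UNIV ?M)"
    using finite_cylinder_measurable[OF f] unfolding measurable_bernoulli_field[of r, symmetric]
    by (simp only: bernoulli_field_def)
  have um: "(\<lambda>(x, \<eta>). \<eta>(i := x)) \<in> ?M i \<Otimes>\<^sub>M ?R \<rightarrow>\<^sub>M Pi\<^sub>M UNIV ?M"
    unfolding case_prod_beta
    by (rule measurable_fun_upd[where J = "UNIV - {i}"]) auto
  obtain M where M: "\<And>\<omega>. \<bar>f \<omega>\<bar> \<le> M" by (rule finite_cylinder_bounded[OF f]) blast
  have int: "integrable (?M i \<Otimes>\<^sub>M ?R) (\<lambda>(x, \<eta>). f (\<eta>(i := x)))"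
    using measurable_compose[OF um fm] M
    by (intro P.integrable_const_bound[of _ M]) (auto simp: case_prod_beta)
  have "bernoulli_field r = distr (?M i \<Otimes>\<^sub>M ?R) (Pi\<^sub>M UNIV ?M) (\<lambda>(x, \<eta>). \<eta>(i := x))"
    using distr_pair_PiM_eq_PiM[of "UNIV - {i}" ?M i]
    by (simp add: prob_space_measure_pmf bernoulli_field_def insert_absorb)
  then have "(\<integral>\<omega>. f \<omega> \<partial>bernoulli_field r) = (\<integral>(x, \<eta>). f (\<eta>(i := x)) \<partial>(?M i \<Otimes>\<^sub>M ?R))"
    by (simp only: integral_distr[OF um fm]) (simp add: case_prod_unfold)
  also have "\<dots> = (\<integral>x. \<integral>\<eta>. f (\<eta>(i := x)) \<partial>?R \<partial>?M i)"
    using P.integral_fst'[OF int] by simp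
  finally show ?thesis .
qed

text \<open>
  Conditioning on site \<open>i\<close>. The conditional expectations do not see the density at \<open>i\<close> any more, so they
  can be taken with respect to any field \<open>s\<close> that differs from \<open>r\<close> at \<open>i\<close> only. This freedom lets the
  shock measures at \<open>j - 1\<close>, \<open>j\<close> and \<open>j + 1\<close> be compared in terms of the same expectations.
\<close>

lemma integral_bernoulli_field_condition:
  assumes f: "finite_cylinder f"
    and r: "0 \<le> r i" "r i \<le> 1"
    and agree: "\<And>k. k \<noteq> i \<Longrightarrow> r k = s k"
  shows "(\<integral>\<omega>. f \<omega> \<partial>bernoulli_field r) =
    r i * (\<integral>\<omega>. f ((\<omega>)(i := True)) \<partial>bernoulli_field s) +
    (1 - r i) * (\<integral>\<omega>. f ((\<omega>)(i := False)) \<partial>bernoulli_field s)"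
proof -
  have R: "(\<Pi>\<^sub>M k\<in>UNIV - {i}. measure_pmf (bernoulli_pmf (r k))) =
           (\<Pi>\<^sub>M k\<in>UNIV - {i}. measure_pmf (bernoulli_pmf (s k)))"
    by (rule PiM_cong) (simp_all add: agree)
  have "(\<integral>\<omega>. f ((\<omega>)(i := b)) \<partial>bernoulli_field s) =
      (\<integral>\<eta>. f (\<eta>(i := b)) \<partial>(\<Pi>\<^sub>M k\<in>UNIV - {i}. measure_pmf (bernoulli_pmf (s k))))" for b
    by (subst integral_bernoulli_field_site[of _ _ i]) (simp_all add: finite_cylinder_update f)
  then show ?thesis
    by (simp add: integral_bernoulli_field_site[OF f, of r i] R r)
qed

lemma integral_bernoulli_field_condition2:
  assumes f: "finite_cylinder f" and "i \<noteq> k"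
    and r: "0 \<le> r i" "r i \<le> 1" "0 \<le> r k" "r k \<le> 1"
    and agree: "\<And>l. l \<noteq> i \<Longrightarrow> l \<noteq> k \<Longrightarrow> r l = s l"
  shows "(\<integral>\<omega>. f \<omega> \<partial>bernoulli_field r) =
    r i * r k * (\<integral>\<omega>. f ((\<omega>)(i := True, k := True)) \<partial>bernoulli_field s) +
    r i * (1 - r k) * (\<integral>\<omega>. f ((\<omega>)(i := True, k := False)) \<partial>bernoulli_field s) +
    (1 - r i) * r k * (\<integral>\<omega>. f ((\<omega>)(i := False, k := True)) \<partial>bernoulli_field s) +
    (1 - r i) * (1 - r k) * (\<integral>\<omega>. f ((\<omega>)(i := False, k := False)) \<partial>bernoulli_field s)"
proof -
  (* The intermediate field already agrees with s away from i, so that r can be changed into s one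
     site at a time. *)
  let ?s = "s(i := r i)"
  have "(\<integral>\<omega>. f ((\<omega>)(k := b)) \<partial>bernoulli_field ?s) =
      r i * (\<integral>\<omega>. f ((\<omega>)(i := True, k := b)) \<partial>bernoulli_field s) +
      (1 - r i) * (\<integral>\<omega>. f ((\<omega>)(i := False, k := b)) \<partial>bernoulli_field s)" for b
    using integral_bernoulli_field_condition[OF finite_cylinder_update[OF f], of ?s i s k b] r
    by simp
  moreover have "(\<integral>\<omega>. f \<omega> \<partial>bernoulli_field r) =
      r k * (\<integral>\<omega>. f ((\<omega>)(k := True)) \<partial>bernoulli_field ?s) +
      (1 - r k) * (\<integral>\<omega>. f ((\<omega>)(k := False)) \<partial>bernoulli_field ?s)"
    using r agree by (intro integral_bernoulli_field_condition[OF f]) auto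
  ultimately show ?thesis by (simp only:) (simp add: algebra_simps)
qed

section \<open>The generator as a sum of bond terms\<close>

definition bond_gen ::
    "real \<Rightarrow> real \<Rightarrow> real \<Rightarrow> real \<Rightarrow> real \<Rightarrow> real \<Rightarrow> (config \<Rightarrow> real) \<Rightarrow> int \<Rightarrow> config \<Rightarrow> real" where
  "bond_gen p q c\<^sub>r c\<^sub>l b\<^sub>l b\<^sub>r \<phi> i \<omega> =
       p * occ \<omega> i * (1 - occ \<omega> (i + 1)) * (\<phi> (jump \<omega> i (i + 1)) - \<phi> \<omega>)
     + q * (1 - occ \<omega> i) * occ \<omega> (i + 1) * (\<phi> (jump \<omega> (i + 1) i) - \<phi> \<omega>)
     + c\<^sub>r * occ \<omega> i * occ \<omega> (i + 1) * (\<phi> (down \<omega> i) - \<phi> \<omega>)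
     + c\<^sub>l * occ \<omega> i * occ \<omega> (i + 1) * (\<phi> (down \<omega> (i + 1)) - \<phi> \<omega>)
     + b\<^sub>l * (1 - occ \<omega> i) * occ \<omega> (i + 1) * (\<phi> (up \<omega> i) - \<phi> \<omega>)
     + b\<^sub>r * occ \<omega> i * (1 - occ \<omega> (i + 1)) * (\<phi> (up \<omega> (i + 1)) - \<phi> \<omega>)"

lemma finite_cylinder_bond_gen:
  assumes "finite_cylinder \<phi>"
  shows "finite_cylinder (bond_gen p q c\<^sub>r c\<^sub>l b\<^sub>l b\<^sub>r \<phi> i)"
  unfolding bond_gen_def[abs_def] jump_def up_def down_def
  by (intro finite_cylinder_combine[where h = "(+)"] finite_cylinder_combine[where h = "(-)"]
      finite_cylinder_combine[where h = "(*)"] finite_cylinder_const finite_cylinder_occ assms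
      finite_cylinder_update[OF assms] finite_cylinder_update[OF finite_cylinder_update[OF assms]])

text \<open>
  The transitions of a single bond: each configuration of its two sites can only change into other
  configurations of the same two sites, and a bond with two empty sites is inert.
\<close>

lemma bond_gen_update:
  "bond_gen p q c\<^sub>r c\<^sub>l b\<^sub>l b\<^sub>r \<phi> i ((\<omega>)(i := True, i + 1 := True)) =
     c\<^sub>r * (\<phi> ((\<omega>)(i := False, i + 1 := True)) - \<phi> ((\<omega>)(i := True, i + 1 := True)))
   + c\<^sub>l * (\<phi> ((\<omega>)(i := True, i + 1 := False)) - \<phi> ((\<omega>)(i := True, i + 1 := True)))"
  "bond_gen p q c\<^sub>r c\<^sub>l b\<^sub>l b\<^sub>r \<phi> i ((\<omega>)(i := True, i + 1 := False)) =
     p * (\<phi> ((\<omega>)(i := False, i + 1 := True)) - \<phi> ((\<omega>)(i := True, i + 1 := False)))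
   + b\<^sub>r * (\<phi> ((\<omega>)(i := True, i + 1 := True)) - \<phi> ((\<omega>)(i := True, i + 1 := False)))"
  "bond_gen p q c\<^sub>r c\<^sub>l b\<^sub>l b\<^sub>r \<phi> i ((\<omega>)(i := False, i + 1 := True)) =
     q * (\<phi> ((\<omega>)(i := True, i + 1 := False)) - \<phi> ((\<omega>)(i := False, i + 1 := True)))
   + b\<^sub>l * (\<phi> ((\<omega>)(i := True, i + 1 := True)) - \<phi> ((\<omega>)(i := False, i + 1 := True)))"
  "bond_gen p q c\<^sub>r c\<^sub>l b\<^sub>l b\<^sub>r \<phi> i ((\<omega>)(i := False, i + 1 := False)) = 0"
  by (simp_all add: bond_gen_def jump_def up_def down_def fun_upd_twist)

text \<open>
  A bond with both ends outside \<open>A\<close> cannot change \<open>\<phi>\<close>. The window starts one site to the left of \<open>A\<close>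
  because the bond \<open>(a, a + 1)\<close> is the first one that may touch \<open>A\<close>; as a consequence, \<open>\<phi>\<close> does not depend
  on site \<open>a\<close>.
\<close>

lemma bcrw_gen_eq_sum:
  assumes A: "\<forall>\<omega> \<eta>. (\<forall>i\<in>A. \<omega> i = \<eta> i) \<longrightarrow> \<phi> \<omega> = \<phi> \<eta>" "A \<subseteq> {a + 1..b}"
  shows "bcrw_gen p q c\<^sub>r c\<^sub>l b\<^sub>l b\<^sub>r \<phi> = (\<lambda>\<omega>. \<Sum>i\<in>{a..b}. bond_gen p q c\<^sub>r c\<^sub>l b\<^sub>l b\<^sub>r \<phi> i \<omega>)"
proof
  fix \<omega>
  have "bond_gen p q c\<^sub>r c\<^sub>l b\<^sub>l b\<^sub>r \<phi> i \<omega> = 0" if "i \<notin> {a..b}" for i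
  proof -
    have off: "\<And>k. k \<in> A \<Longrightarrow> k \<noteq> i" "\<And>k. k \<in> A \<Longrightarrow> k \<noteq> i + 1"
      using that A(2) by force+
    have "\<phi> (jump \<omega> i (i + 1)) = \<phi> \<omega>" "\<phi> (jump \<omega> (i + 1) i) = \<phi> \<omega>" "\<phi> (down \<omega> i) = \<phi> \<omega>"
      "\<phi> (down \<omega> (i + 1)) = \<phi> \<omega>" "\<phi> (up \<omega> i) = \<phi> \<omega>" "\<phi> (up \<omega> (i + 1)) = \<phi> \<omega>"
      using off by (auto intro!: A(1)[rule_format] simp: jump_def up_def down_def)
    then show ?thesis by (simp add: bond_gen_def)
  qed
  then have "infsum (\<lambda>i. bond_gen p q c\<^sub>r c\<^sub>l b\<^sub>l b\<^sub>r \<phi> i \<omega>) UNIV =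
      infsum (\<lambda>i. bond_gen p q c\<^sub>r c\<^sub>l b\<^sub>l b\<^sub>r \<phi> i \<omega>) {a..b}"
    by (intro infsum_cong_neutral) auto
  then show "bcrw_gen p q c\<^sub>r c\<^sub>l b\<^sub>l b\<^sub>r \<phi> \<omega> = (\<Sum>i\<in>{a..b}. bond_gen p q c\<^sub>r c\<^sub>l b\<^sub>l b\<^sub>r \<phi> i \<omega>)"
    by (simp add: bcrw_gen_def bond_gen_def)
qed

lemma finite_cylinder_window:
  assumes "finite_cylinder \<phi>"
  obtains A a b where "\<forall>\<omega> \<eta>. (\<forall>i\<in>A. \<omega> i = \<eta> i) \<longrightarrow> \<phi> \<omega> = \<phi> \<eta>"
    "A \<subseteq> {a + 1..b}" "a < m" "m \<le> b"
proof -
  obtain A where "finite A" and A: "\<forall>\<omega> \<eta>. (\<forall>i\<in>A. \<omega> i = \<eta> i) \<longrightarrow> \<phi> \<omega> = \<phi> \<eta>"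
    using assms unfolding finite_cylinder_def by metis
  have "Min (insert m A) \<le> k" "k \<le> Max (insert m A)" if "k \<in> insert m A" for k
    using that \<open>finite A\<close> by (simp_all del: Min_insert Max_insert)
  then show ?thesis
    by (intro that[of A "Min (insert m A) - 1" "Max (insert m A)"] A) fastforce+
qed

lemma finite_cylinder_bcrw_gen:
  assumes "finite_cylinder \<phi>"
  shows "finite_cylinder (bcrw_gen p q c\<^sub>r c\<^sub>l b\<^sub>l b\<^sub>r \<phi>)"
proof -
  obtain A a b where A: "\<forall>\<omega> \<eta>. (\<forall>i\<in>A. \<omega> i = \<eta> i) \<longrightarrow> \<phi> \<omega> = \<phi> \<eta>" "A \<subseteq> {a + 1..b}"
    using finite_cylinder_window[OF assms] by metis
  show ?thesis
    unfolding bcrw_gen_eq_sum[OF A] by (intro finite_cylinder_sum finite_cylinder_bond_gen assms)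
qed

section \<open>Expected bond terms\<close>

lemma integral_bond_gen:
  assumes \<phi>: "finite_cylinder \<phi>"
    and r: "0 \<le> r i" "r i \<le> 1" "0 \<le> r (i + 1)" "r (i + 1) \<le> 1"
  defines "e \<equiv> (\<lambda>b c. \<integral>\<omega>. \<phi> ((\<omega>)(i := b, i + 1 := c)) \<partial>bernoulli_field r)"
  shows "(\<integral>\<omega>. bond_gen p q c\<^sub>r c\<^sub>l b\<^sub>l b\<^sub>r \<phi> i \<omega> \<partial>bernoulli_field r) =
    r i * r (i + 1) * (c\<^sub>r * (e False True - e True True) + c\<^sub>l * (e True False - e True True))
    + r i * (1 - r (i + 1)) * (p * (e False True - e True False) + b\<^sub>r * (e True True - e True False))
    + (1 - r i) * r (i + 1) * (q * (e True False - e False True) + b\<^sub>l * (e True True - e False True))"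
proof -
  have int: "integrable (bernoulli_field r) (\<lambda>\<omega>. \<phi> ((\<omega>)(i := b, i + 1 := c)))" for b c
    using finite_cylinder_integrable[OF finite_cylinder_update[OF finite_cylinder_update[OF \<phi>]]] .
  show ?thesis
    unfolding integral_bernoulli_field_condition2[of "bond_gen p q c\<^sub>r c\<^sub>l b\<^sub>l b\<^sub>r \<phi> i" i "i + 1" r r,
        OF finite_cylinder_bond_gen[OF \<phi>] _ r refl, simplified bond_gen_update, simplified]
    by (simp add: int e_def)
qed

text \<open>
  Within a region of constant density \<open>\<rho>\<close> with balanced branching and coalescence, the bond term acts
  on the two-site law by moving mass from \<open>01\<close> to \<open>10\<close> (or back): the probability of \<open>11\<close> is
  preserved by \<open>balance\<close>, and \<open>\<rho> (1 - \<rho>) \<kappa>\<close> is the net gain of \<open>10\<close>. Relative to the product law this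
  signed measure has density \<open>\<kappa> (\<omega>\<^sub>i - \<omega>\<^sub>i\<^sub>+\<^sub>1)\<close>, a discrete gradient.
\<close>

lemma integral_bond_gen_bulk:
  assumes \<phi>: "finite_cylinder \<phi>"
    and r: "r i = \<rho>" "r (i + 1) = \<rho>" and \<rho>: "0 \<le> \<rho>" "\<rho> \<le> 1"
    and balance: "(b\<^sub>l + b\<^sub>r) * (1 - \<rho>) = (c\<^sub>l + c\<^sub>r) * \<rho>"
    and drift: "\<kappa> * (1 - \<rho>) = (q - p - b\<^sub>r) * (1 - \<rho>) + c\<^sub>l * \<rho>"
  shows "(\<integral>\<omega>. bond_gen p q c\<^sub>r c\<^sub>l b\<^sub>l b\<^sub>r \<phi> i \<omega> \<partial>bernoulli_field r) =
    \<kappa> * ((\<integral>\<omega>. occ \<omega> i * \<phi> \<omega> \<partial>bernoulli_field r) -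
         (\<integral>\<omega>. occ \<omega> (i + 1) * \<phi> \<omega> \<partial>bernoulli_field r))"
proof -
  define e where "e b c = (\<integral>\<omega>. \<phi> ((\<omega>)(i := b, i + 1 := c)) \<partial>bernoulli_field r)" for b c
  have cyl: "finite_cylinder (\<lambda>\<omega>. occ \<omega> k * \<phi> \<omega>)" for k
    by (intro finite_cylinder_combine[where h = "(*)"] finite_cylinder_occ \<phi>)
  have left: "(\<integral>\<omega>. occ \<omega> i * \<phi> \<omega> \<partial>bernoulli_field r) =
      \<rho> * \<rho> * e True True + \<rho> * (1 - \<rho>) * e True False"
    using \<rho> by (subst integral_bernoulli_field_condition2[OF cyl, of i "i + 1" r r]) (simp_all add: r e_def)
  have right: "(\<integral>\<omega>. occ \<omega> (i + 1) * \<phi> \<omega> \<partial>bernoulli_field r) =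
      \<rho> * \<rho> * e True True + (1 - \<rho>) * \<rho> * e False True"
    using \<rho> by (subst integral_bernoulli_field_condition2[OF cyl, of i "i + 1" r r]) (simp_all add: r e_def)
  have "(\<integral>\<omega>. bond_gen p q c\<^sub>r c\<^sub>l b\<^sub>l b\<^sub>r \<phi> i \<omega> \<partial>bernoulli_field r) =
    \<rho> * \<rho> * (c\<^sub>r * (e False True - e True True) + c\<^sub>l * (e True False - e True True))
    + \<rho> * (1 - \<rho>) * (p * (e False True - e True False) + b\<^sub>r * (e True True - e True False))
    + (1 - \<rho>) * \<rho> * (q * (e True False - e False True) + b\<^sub>l * (e True True - e False True))"
    using integral_bond_gen[OF \<phi>, of r i] \<rho> by (simp add: r e_def)
  (* The last two summands are multiples of the defects of the equations balance and drift. *)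
  also have "\<dots> = \<kappa> * ((\<rho> * \<rho> * e True True + \<rho> * (1 - \<rho>) * e True False) -
      (\<rho> * \<rho> * e True True + (1 - \<rho>) * \<rho> * e False True))
    + \<rho> * (e True True - e False True) * ((b\<^sub>l + b\<^sub>r) * (1 - \<rho>) - (c\<^sub>l + c\<^sub>r) * \<rho>)
    + \<rho> * (e False True - e True False) * (\<kappa> * (1 - \<rho>) - ((q - p - b\<^sub>r) * (1 - \<rho>) + c\<^sub>l * \<rho>))"
    by algebra
  finally show ?thesis by (simp add: balance drift left right)
qed

section \<open>The shock measure\<close>

definition shock_density :: "real \<Rightarrow> int \<Rightarrow> int \<Rightarrow> real" where
  "shock_density \<rho> j i = (if i < j then \<rho> else if i = j then 1 else 0)"

lemma shock_measure_eq: "shock_measure \<rho> j = bernoulli_field (shock_density \<rho> j)"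
  by (simp add: shock_measure_def bernoulli_field_def shock_density_def)

lemma sum_int_telescope:
  fixes h :: "int \<Rightarrow> real"
  assumes "a \<le> n"
  shows "(\<Sum>i\<in>{a..<n}. h i - h (i + 1)) = h a - h n"
  using assms
proof (induction n rule: int_ge_induct)
  case (step n)
  then have "{a..<n + 1} = insert n {a..<n}" by auto
  with step show ?case by simp
qed simp

text \<open>
  The three hypotheses on \<open>P\<close> and \<open>Q\<close> are the forms in which the rates arise: a forward move leaves site
  \<open>j\<close> empty with weight \<open>P (1 - \<rho>) = p\<close> and occupied with weight \<open>P \<rho> = b\<^sub>r\<close>, and a backward move happens by
  a jump or a coalescence, according to the state of \<open>j - 1\<close>.
\<close>

lemma integral_bcrw_gen_shock_measure:
  assumes \<phi>: "finite_cylinder \<phi>" and \<rho>: "0 \<le> \<rho>" "\<rho> < 1"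
    and balance: "(b\<^sub>l + b\<^sub>r) * (1 - \<rho>) = (c\<^sub>l + c\<^sub>r) * \<rho>"
    and P: "P * (1 - \<rho>) = p" "P * \<rho> = b\<^sub>r"
    and Q: "Q = q * (1 - \<rho>) + c\<^sub>l * \<rho>"
  shows "(\<integral>\<omega>. bcrw_gen p q c\<^sub>r c\<^sub>l b\<^sub>l b\<^sub>r \<phi> \<omega> \<partial>shock_measure \<rho> j)
         = P * ((\<integral>\<omega>. \<phi> \<omega> \<partial>shock_measure \<rho> (j + 1)) - (\<integral>\<omega>. \<phi> \<omega> \<partial>shock_measure \<rho> j))
         + Q * ((\<integral>\<omega>. \<phi> \<omega> \<partial>shock_measure \<rho> (j - 1)) - (\<integral>\<omega>. \<phi> \<omega> \<partial>shock_measure \<rho> j))"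
proof -
  define r where "r = shock_density \<rho> j"
  have r: "i < j \<Longrightarrow> r i = \<rho>" "r j = 1" "j < i \<Longrightarrow> r i = 0" for i
    by (simp_all add: r_def shock_density_def)
  define E where "E f = (\<integral>\<omega>. f \<omega> \<partial>bernoulli_field r)" for f :: "config \<Rightarrow> real"
  define e where "e b c = E (\<lambda>\<omega>. \<phi> ((\<omega>)(j - 1 := b, j := c)))" for b c
  define f where "f b c = E (\<lambda>\<omega>. \<phi> ((\<omega>)(j := b, j + 1 := c)))" for b c
  define h where "h i = E (\<lambda>\<omega>. occ \<omega> i * \<phi> \<omega>)" for i
  define T where "T i = E (bond_gen p q c\<^sub>r c\<^sub>l b\<^sub>l b\<^sub>r \<phi> i)" for i
  define \<kappa> where "\<kappa> = q - p - b\<^sub>r + c\<^sub>l * \<rho> / (1 - \<rho>)"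
  have drift: "\<kappa> * (1 - \<rho>) = (q - p - b\<^sub>r) * (1 - \<rho>) + c\<^sub>l * \<rho>"
    using \<rho> by (simp add: \<kappa>_def field_simps)
  have cyl: "finite_cylinder (\<lambda>\<omega>. occ \<omega> k * \<phi> \<omega>)" for k
    by (intro finite_cylinder_combine[where h = "(*)"] finite_cylinder_occ \<phi>)
  obtain A a b where A: "\<forall>\<omega> \<eta>. (\<forall>i\<in>A. \<omega> i = \<eta> i) \<longrightarrow> \<phi> \<omega> = \<phi> \<eta>" "A \<subseteq> {a + 1..b}"
    and ab: "a < j" "j \<le> b"
    using finite_cylinder_window[OF \<phi>, of j] by metis

  (* All integrals of \<phi> in terms of the conditional expectations e on (j - 1, j) and f on (j, j + 1).
     The integral with respect to the measure at j itself is needed in both forms. *)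
  have \<mu>: "E \<phi> = \<rho> * e True True + (1 - \<rho>) * e False True"
    using integral_bernoulli_field_condition2[OF \<phi>, of "j - 1" j r r] \<rho>
    by (simp add: E_def e_def r)
  have \<mu>': "E \<phi> = f True False"
    using integral_bernoulli_field_condition2[OF \<phi>, of j "j + 1" r r] \<rho>
    by (simp add: E_def f_def r)
  have \<mu>_left: "(\<integral>\<omega>. \<phi> \<omega> \<partial>shock_measure \<rho> (j - 1)) = e True False"
    using integral_bernoulli_field_condition2[OF \<phi>, of "j - 1" j "shock_density \<rho> (j - 1)" r] \<rho>
    by (simp add: E_def e_def r_def shock_density_def shock_measure_eq)
  have \<mu>_right: "(\<integral>\<omega>. \<phi> \<omega> \<partial>shock_measure \<rho> (j + 1)) = \<rho> * f True True + (1 - \<rho>) * f False True"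
    using integral_bernoulli_field_condition2[OF \<phi>, of j "j + 1" "shock_density \<rho> (j + 1)" r] \<rho>
    by (simp add: E_def f_def r_def shock_density_def shock_measure_eq)

  (* The two ends of the telescoping sum. At site a, the occupation is independent of \<phi>. *)
  have "\<phi> ((\<omega>)(a := x)) = \<phi> \<omega>" for \<omega> x
    using A(2) by (intro A(1)[rule_format]) auto
  then have h_a: "h a = \<rho> * E \<phi>"
    using integral_bernoulli_field_condition[OF cyl, of r a r a] \<rho> ab
    by (simp add: h_def E_def r)
  have h_j: "h (j - 1) = \<rho> * e True True"
    using integral_bernoulli_field_condition2[OF cyl, of "j - 1" j r r "j - 1"] \<rho>
    by (simp add: h_def E_def e_def r)

  have bulk: "T i = \<kappa> * (h i - h (i + 1))" if "i < j - 1" for i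
    unfolding T_def h_def E_def
    using that \<rho> by (intro integral_bond_gen_bulk[OF \<phi> _ _ _ _ balance drift]) (simp_all add: r)
  have left_bond: "T (j - 1) =
      \<rho> * (c\<^sub>r * (e False True - e True True) + c\<^sub>l * (e True False - e True True))
      + (1 - \<rho>) * (q * (e True False - e False True) + b\<^sub>l * (e True True - e False True))"
    using integral_bond_gen[OF \<phi>, of r "j - 1"] \<rho> by (simp add: T_def E_def e_def r)
  have right_bond: "T j = p * (f False True - f True False) + b\<^sub>r * (f True True - f True False)"
    using integral_bond_gen[OF \<phi>, of r j] \<rho> by (simp add: T_def E_def f_def r)
  have vacuum: "T i = 0" if "j < i" for i
    using integral_bond_gen[OF \<phi>, of r i] that by (simp add: T_def E_def r)

  have "(\<integral>\<omega>. bcrw_gen p q c\<^sub>r c\<^sub>l b\<^sub>l b\<^sub>r \<phi> \<omega> \<partial>shock_measure \<rho> j) = (\<Sum>i\<in>{a..b}. T i)"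
    unfolding bcrw_gen_eq_sum[OF A] shock_measure_eq r_def[symmetric] T_def E_def
    by (intro Bochner_Integration.integral_sum finite_cylinder_integrable finite_cylinder_bond_gen \<phi>)
  also have "\<dots> = (\<Sum>i\<in>{a..j}. T i)"
    using ab vacuum by (intro sum.mono_neutral_right) auto
  also have "{a..j} = insert j (insert (j - 1) {a..<j - 1})"
    using ab by auto
  also have "(\<Sum>i\<in>\<dots>. T i) = (\<Sum>i\<in>{a..<j - 1}. T i) + T (j - 1) + T j"
    by simp
  also have "(\<Sum>i\<in>{a..<j - 1}. T i) = \<kappa> * (\<Sum>i\<in>{a..<j - 1}. h i - h (i + 1))"
    by (simp add: bulk sum_distrib_left)
  also have "\<dots> = \<kappa> * (\<rho> * E \<phi> - \<rho> * e True True)"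
    using ab by (simp add: sum_int_telescope h_a h_j)
  also have "\<dots> = (\<kappa> * (1 - \<rho>)) * \<rho> * (e False True - e True True)"
    by (simp add: \<mu> algebra_simps)
  (* Here the boundary term of the bulk absorbs the change of density at j - 1. The drift contains
     (p + b\<^sub>r) \<rho> = P \<rho> = b\<^sub>r, which completes the b\<^sub>l of the left bond to b\<^sub>l + b\<^sub>r, as balance requires. *)
  also have "\<dots> + T (j - 1) = Q * (e True False - E \<phi>)"
    unfolding left_bond \<mu> drift Q using balance P by algebra
  also have "T j = P * (\<rho> * f True True + (1 - \<rho>) * f False True - E \<phi>)"
    unfolding right_bond \<mu>' P[symmetric] by (simp add: algebra_simps)
  finally show ?thesis
    unfolding \<mu>_left \<mu>_right by (simp add: shock_measure_eq E_def r_def)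
qed

section \<open>The time derivative at zero\<close>

text \<open>
  By Fubini's theorem for kernels the integral of \<open>\<phi>\<close> against the evolved law is the integral of \<open>S(t)\<phi>\<close>
  against \<open>\<mu>\<close>. The difference quotients of \<open>S(t)\<phi>\<close> converge uniformly to \<open>g\<close>, hence so do their integrals
  against the probability measure \<open>\<mu>\<close>.
\<close>

lemma has_real_derivative_evolved_law:
  assumes \<mu>: "prob_space \<mu>" and sets [measurable_cong]: "sets \<mu> = sets config_space"
    and K: "feller_process K" and gen: "has_generator_value K \<phi> g"
    and \<phi>: "finite_cylinder \<phi>" and g: "finite_cylinder g"
  shows "((\<lambda>t. \<integral>\<omega>. \<phi> \<omega> \<partial>evolved_law \<mu> K t) has_real_derivative (\<integral>\<omega>. g \<omega> \<partial>\<mu>)) (at 0 within {0..})"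
proof -
  interpret \<mu>: prob_space \<mu> by fact
  note [measurable] = finite_cylinder_measurable[OF \<phi>] finite_cylinder_measurable[OF g]
  have space: "space \<mu> = UNIV" using sets_eq_imp_space_eq[OF sets] by simp
  obtain M where M: "\<And>\<omega>. \<bar>\<phi> \<omega>\<bar> \<le> M" by (rule finite_cylinder_bounded[OF \<phi>]) blast
  obtain N where N: "\<And>\<omega>. \<bar>g \<omega>\<bar> \<le> N" by (rule finite_cylinder_bounded[OF g]) blast
  have int_g: "integrable \<mu> g"
    using N by (intro \<mu>.integrable_const_bound[of _ N]) auto
  have int_\<phi>: "integrable \<mu> \<phi>"
    using M by (intro \<mu>.integrable_const_bound[of _ M]) auto
  have kernel: "K t \<in> \<mu> \<rightarrow>\<^sub>M prob_algebra config_space" if "0 \<le> t" for t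
    using K that unfolding feller_process_def measurable_cong_sets[OF sets refl] by simp
  have law: "prob_space (K t \<omega>)" "sets (K t \<omega>) = sets config_space" if "0 \<le> t" for t \<omega>
    using measurable_space[OF kernel[OF that], of \<omega>] by (simp_all add: space space_prob_algebra)
  have int_S: "integrable \<mu> (semigroup_op K t \<phi>)" if t: "0 \<le> t" for t
  proof (rule \<mu>.integrable_const_bound[of _ M])
    have "\<bar>semigroup_op K t \<phi> \<omega>\<bar> \<le> M" for \<omega>
    proof -
      interpret L: prob_space "K t \<omega>" by (rule law[OF t])
      have int: "integrable (K t \<omega>) \<phi>"
        using M finite_cylinder_measurable[OF \<phi>]
        unfolding measurable_cong_sets[OF law(2)[OF t, of \<omega>, symmetric] refl]
        by (intro L.integrable_const_bound[of _ M]) auto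
      have "\<bar>\<integral>\<eta>. \<phi> \<eta> \<partial>K t \<omega>\<bar> \<le> (\<integral>\<eta>. \<bar>\<phi> \<eta>\<bar> \<partial>K t \<omega>)"
        by (rule integral_abs_bound)
      also have "\<dots> \<le> M"
        using int M by (intro L.integral_le_const) auto
      finally show ?thesis by (simp add: semigroup_op_def)
    qed
    then show "AE \<omega> in \<mu>. norm (semigroup_op K t \<phi> \<omega>) \<le> M" by simp
    show "semigroup_op K t \<phi> \<in> borel_measurable \<mu>"
      unfolding semigroup_op_def[abs_def]
      by (rule measurable_compose[OF measurable_prob_algebraD[OF kernel[OF t]]
            integral_measurable_subprob_algebra]) measurable
  qed
  have evolved: "(\<integral>\<omega>. \<phi> \<omega> \<partial>evolved_law \<mu> K t) = (\<integral>\<omega>. semigroup_op K t \<phi> \<omega> \<partial>\<mu>)" if t: "0 \<le> t" for t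
    unfolding evolved_law_def semigroup_op_def
    using M law(1)[OF t, THEN prob_space.emeasure_space_1]
    by (intro integral_bind[where K = config_space and B = M and B' = 1] measurable_prob_algebraD
        kernel[OF t] \<mu>.finite_measure_axioms) auto
  have "K 0 \<omega> = return config_space \<omega>" for \<omega>
    using K by (simp add: feller_process_def)
  then have S0: "semigroup_op K 0 \<phi> \<omega> = \<phi> \<omega>" for \<omega>
    unfolding semigroup_op_def by (simp add: integral_return)
  have quotient: "((\<integral>\<omega>. \<phi> \<omega> \<partial>evolved_law \<mu> K t) - (\<integral>\<omega>. \<phi> \<omega> \<partial>evolved_law \<mu> K 0)) / t =
      (\<integral>\<omega>. (semigroup_op K t \<phi> \<omega> - \<phi> \<omega>) / t \<partial>\<mu>)" if "0 < t" for t
    using that int_S[of t] int_\<phi> by (simp add: evolved S0)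
  have "((\<lambda>t. ((\<integral>\<omega>. \<phi> \<omega> \<partial>evolved_law \<mu> K t) - (\<integral>\<omega>. \<phi> \<omega> \<partial>evolved_law \<mu> K 0)) / t)
      \<longlongrightarrow> (\<integral>\<omega>. g \<omega> \<partial>\<mu>)) (at_right 0)"
  proof (rule tendstoI)
    fix \<epsilon> :: real
    assume "0 < \<epsilon>"
    then have "\<forall>\<^sub>F t in at_right 0. \<forall>\<omega>\<in>UNIV. dist ((semigroup_op K t \<phi> \<omega> - \<phi> \<omega>) / t) (g \<omega>) < \<epsilon> / 2"
      using gen by (intro uniform_limitD) (simp_all add: has_generator_value_def)
    then show "\<forall>\<^sub>F t in at_right 0.
        dist (((\<integral>\<omega>. \<phi> \<omega> \<partial>evolved_law \<mu> K t) - (\<integral>\<omega>. \<phi> \<omega> \<partial>evolved_law \<mu> K 0)) / t) (\<integral>\<omega>. g \<omega> \<partial>\<mu>) < \<epsilon>"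
      using eventually_at_right_less[of 0]
    proof eventually_elim
      case (elim t)
      let ?d = "\<lambda>\<omega>. (semigroup_op K t \<phi> \<omega> - \<phi> \<omega>) / t - g \<omega>"
      have int: "integrable \<mu> (\<lambda>\<omega>. (semigroup_op K t \<phi> \<omega> - \<phi> \<omega>) / t)"
        using elim int_S[of t] int_\<phi> by simp
      have "\<bar>\<integral>\<omega>. ?d \<omega> \<partial>\<mu>\<bar> \<le> (\<integral>\<omega>. \<bar>?d \<omega>\<bar> \<partial>\<mu>)"
        by (rule integral_abs_bound)
      also have "\<dots> \<le> \<epsilon> / 2"
        using elim(1) int int_g by (intro \<mu>.integral_le_const) (auto simp: dist_real_def less_imp_le)
      also have "\<dots> < \<epsilon>" using \<open>0 < \<epsilon>\<close> by simp
      finally show ?case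
        using int int_g by (simp only: quotient[OF elim(2)] dist_real_def Bochner_Integration.integral_diff)
    qed
  qed
  moreover have "at 0 within {0..} = at_right (0::real)"
    unfolding at_within_def by (intro arg_cong2[where f = inf] arg_cong[where f = principal]) auto
  ultimately show ?thesis by (simp add: has_field_derivative_iff)
qed

theorem theorem5p1:
  fixes p q c\<^sub>r c\<^sub>l b\<^sub>l b\<^sub>r B C \<rho> P Q :: real
    and j :: int and \<phi> :: "config \<Rightarrow> real"
  assumes "p > 0" "q > 0" "c\<^sub>r > 0" "c\<^sub>l > 0" "b\<^sub>l > 0" "b\<^sub>r > 0"
    and "B = b\<^sub>l + b\<^sub>r" and "C = c\<^sub>l + c\<^sub>r" and "\<rho> = B / (B + C)"
    and "p = b\<^sub>r * (C / B)"
    and "P = p * ((C + B) / C)"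
    and "Q = q * (C / (C + B)) + c\<^sub>l * (B / (C + B))"
    and "finite_cylinder \<phi>"
  shows "(\<forall>K. bcrw_process p q c\<^sub>r c\<^sub>l b\<^sub>l b\<^sub>r K \<longrightarrow>
            ((\<lambda>t. \<integral>\<omega>. \<phi> \<omega> \<partial>evolved_law (shock_measure \<rho> j) K t) has_real_derivative
               (\<integral>\<omega>. bcrw_gen p q c\<^sub>r c\<^sub>l b\<^sub>l b\<^sub>r \<phi> \<omega> \<partial>shock_measure \<rho> j)) (at 0 within {0..}))
       \<and> (\<integral>\<omega>. bcrw_gen p q c\<^sub>r c\<^sub>l b\<^sub>l b\<^sub>r \<phi> \<omega> \<partial>shock_measure \<rho> j)
         = P * ((\<integral>\<omega>. \<phi> \<omega> \<partial>shock_measure \<rho> (j + 1)) - (\<integral>\<omega>. \<phi> \<omega> \<partial>shock_measure \<rho> j))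
         + Q * ((\<integral>\<omega>. \<phi> \<omega> \<partial>shock_measure \<rho> (j - 1)) - (\<integral>\<omega>. \<phi> \<omega> \<partial>shock_measure \<rho> j))"
proof -
  have pos: "0 < B" "0 < C" using assms by simp_all
  then have \<rho>: "0 \<le> \<rho>" "\<rho> < 1" "1 - \<rho> = C / (C + B)"
    unfolding \<open>\<rho> = _\<close> by (simp_all add: field_simps)
  have balance: "(b\<^sub>l + b\<^sub>r) * (1 - \<rho>) = (c\<^sub>l + c\<^sub>r) * \<rho>"
    unfolding \<rho>(3) \<open>B = _\<close>[symmetric] \<open>C = _\<close>[symmetric] unfolding \<open>\<rho> = _\<close>
    by (simp add: add.commute)
  have P: "P * (1 - \<rho>) = p" "P * \<rho> = b\<^sub>r"
    using pos add_pos_pos[OF pos] unfolding \<rho>(3) unfolding \<open>\<rho> = _\<close> \<open>P = _\<close> \<open>p = _\<close>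
    by (simp_all add: add.commute[of C B])
  have Q: "Q = q * (1 - \<rho>) + c\<^sub>l * \<rho>"
    unfolding \<rho>(3) unfolding \<open>Q = _\<close> \<open>\<rho> = _\<close> by (simp add: add.commute)
  have "((\<lambda>t. \<integral>\<omega>. \<phi> \<omega> \<partial>evolved_law (shock_measure \<rho> j) K t) has_real_derivative
      (\<integral>\<omega>. bcrw_gen p q c\<^sub>r c\<^sub>l b\<^sub>l b\<^sub>r \<phi> \<omega> \<partial>shock_measure \<rho> j)) (at 0 within {0..})"
    if K: "bcrw_process p q c\<^sub>r c\<^sub>l b\<^sub>l b\<^sub>r K" for K
    using K \<open>finite_cylinder \<phi>\<close> unfolding bcrw_process_def
    by (intro has_real_derivative_evolved_law)
      (simp_all add: shock_measure_eq prob_space_bernoulli_field finite_cylinder_bcrw_gen)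
  then show ?thesis
    using integral_bcrw_gen_shock_measure[OF \<open>finite_cylinder \<phi>\<close> \<rho>(1,2) balance P Q] by simp
qed

end
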